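(* Assume the following. (a) $\lambda$ is a singular cardinal, $\kappa=\mathrm{cf}(\lambda)$, and $\langle\lambda_i:i<\kappa\rangle$ is an increasing and continuous sequence of cardinals with $\lambda_0=0$, $\kappa\le\lambda_1$ and $\lambda=\sum_{i<\kappa}\lambda_i$. (b) For $i<\kappa$, $S_i=\{A\subseteq\lambda:|A|=\lambda_i\}$ and $S'_i=S_i\cup\{\emptyset\}$. (c) $\mathbf F$ is a family of pairs $(A,B)$ with $\lambda\supseteq A\supseteq B$; write $A/B\in\mathbf F$ for $(A,B)\in\mathbf F$. (No further axioms on $\mathbf F$ are assumed.) (d) (Hypothesis I) For each successor $i<\kappa$ there is a two-place function $g_i$ from $S'_i$ to $S'_i$ (that is, $g_i:S'_i\times S'_i\to S'_i$) such that: if $A_1\subseteq A_2$ are from $S'_i$ and $A_1\in\{\emptyset\}\cup\mathrm{Range}(g_i)$, then $A_2\subseteq g_i(A_1,A_2)$ and $g_i(A_1,A_2)/A_1\in\mathbf F$. (e) (Hypothesis II) If $i<\kappa$, $A,B\in S'_{i+1}$, $A\subseteq B$, $B/A\in\mathbf F$ and $B\in\mathrm{Range}(g_{i+1})$, then player II has a winning strategy in the following game $Gm_i[A,B]$: in the $n$-th move ($n<\omega$) player I chooses $A_n\in S_i$ such that $B_{n-1}\subseteq A_n$, and then player II chooses $B_n$ such that $A_n\subseteq B_n\in S_i$ (where $B_{-1}=\emptyset$). Player II wins the play if $\bigl(B\cup\bigcup_{n<\omega}B_n,\ A\cup\bigcup_{n<\omega}B_n\bigr)\in\mathbf F$. (For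 $i=0$ this is an empty demand, as $S'_0=\{\emptyset\}$.) Then there is an increasing and continuous chain $\langle A_\alpha:\alpha<\omega\kappa\rangle$ such that $A_0=\emptyset$, $\lambda=\bigcup_{\alpha<\omega\kappa}A_\alpha$, and $A_{\alpha+1}/A_\alpha\in\mathbf F$ for each $\alpha<\omega\kappa$.
   Context: A cardinal is identified with the corresponding initial ordinal, so subsets of $\lambda$ are sets of ordinals below $\lambda$. A sequence (of cardinals or sets) is continuous if at each limit index its value is the supremum/union of the earlier values. The ordinal $\omega\kappa$ is the ordinal product (the order type of $\kappa$ consecutive copies of $\omega$), whose elements are the ordinals $\omega i+k$ with $i<\kappa$, $k<\omega$. *)

theory Defs
  imports Main "HOL-Library.FuncSet"
begin

unbundle cardinal_syntax

text \<open>
  An ordinal is represented by a well-order relation, its elements (the smaller ordinals) being the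
  members of the field. A cardinal is a well-order relation satisfying
  \<^const>\<open>card_order_on\<close> on its field, so a subset of the cardinal \<open>lam\<close> is a
  subset of \<open>Field lam\<close>.
\<close>

definition ord_zero :: "'i rel \<Rightarrow> 'i" where
  "ord_zero r = wo_rel.minim r (Field r)"

definition ord_succ :: "'i rel \<Rightarrow> 'i \<Rightarrow> 'i" where
  "ord_succ r i = wo_rel.suc r {i}"

definition is_succ :: "'i rel \<Rightarrow> 'i \<Rightarrow> bool" where
  "is_succ r i \<longleftrightarrow> (\<exists>j\<in>Field r. aboveS r j \<noteq> {} \<and> i = ord_succ r j)"

definition is_limit :: "'i rel \<Rightarrow> 'i \<Rightarrow> bool" where
  "is_limit r i \<longleftrightarrow> i \<in> Field r \<and> i \<noteq> ord_zero r \<and> \<not> is_succ r i"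

text \<open>
  The ordinal product, i.e. the order type of \<open>s\<close> consecutive copies of \<open>r\<close>: the pair
  \<open>(k, i)\<close> stands for the ordinal \<open>r * i + k\<close>, so the second coordinate is the
  dominant one.
\<close>

definition ord_prod :: "'a rel \<Rightarrow> 'b rel \<Rightarrow> ('a \<times> 'b) rel" where
  "ord_prod r s = {((k, i), (l, j)). k \<in> Field r \<and> l \<in> Field r \<and> i \<in> Field s \<and> j \<in> Field s \<and>
     ((i, j) \<in> s \<and> i \<noteq> j \<or> i = j \<and> (k, l) \<in> r)}"

definition is_cofinality :: "'a rel \<Rightarrow> 'k rel \<Rightarrow> bool" where
  "is_cofinality lam kappa \<longleftrightarrow> Card_order kappa \<and>
     (\<exists>K. K \<subseteq> Field lam \<and> cofinal K lam \<and> |K| =o kappa) \<and>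
     (\<forall>K. K \<subseteq> Field lam \<and> cofinal K lam \<longrightarrow> kappa \<le>o |K| )"

definition singular_card :: "'a rel \<Rightarrow> bool" where
  "singular_card lam \<longleftrightarrow> Cinfinite lam \<and> \<not> regularCard lam"

definition card_increasing :: "'i rel \<Rightarrow> ('i \<Rightarrow> 'c rel) \<Rightarrow> bool" where
  "card_increasing r L \<longleftrightarrow> (\<forall>i j. (i, j) \<in> r \<and> i \<noteq> j \<longrightarrow> L i <o L j)"

text \<open>
  At a limit index the value is the supremum (as an ordinal) of the earlier values. Testing
  minimality against well-orders \<open>u\<close> of the same type loses nothing, since every ordinal
  below \<open>L i\<close> is represented on that type.
\<close>

definition card_continuous :: "'i rel \<Rightarrow> ('i \<Rightarrow> 'c rel) \<Rightarrow> bool" where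
  "card_continuous r L \<longleftrightarrow> (\<forall>i. is_limit r i \<longrightarrow>
     (\<forall>j\<in>underS r i. L j \<le>o L i) \<and>
     (\<forall>u :: 'c rel. Well_order u \<and> (\<forall>j\<in>underS r i. L j \<le>o u) \<longrightarrow> L i \<le>o u))"

definition set_continuous :: "'i rel \<Rightarrow> ('i \<Rightarrow> 'a set) \<Rightarrow> bool" where
  "set_continuous r A \<longleftrightarrow> (\<forall>i. is_limit r i \<longrightarrow> A i = (\<Union>j\<in>underS r i. A j))"

text \<open>
  \<open>subsets_of_card lam (L i)\<close> is \<open>S\<close> at \<open>i\<close>, and
  \<open>subsets_of_card0 lam (L i)\<close> is \<open>S'\<close> at \<open>i\<close>.
\<close>

definition subsets_of_card :: "'a rel \<Rightarrow> 'c rel \<Rightarrow> 'a set set" where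
  "subsets_of_card lam mu = {A. A \<subseteq> Field lam \<and> |A| =o mu}"

definition subsets_of_card0 :: "'a rel \<Rightarrow> 'c rel \<Rightarrow> 'a set set" where
  "subsets_of_card0 lam mu = subsets_of_card lam mu \<union> {{}}"

text \<open>
  The game in which player I plays \<open>X 0, X 1, \<dots>\<close> and player II plays
  \<open>Y 0, Y 1, \<dots>\<close>, all moves in \<open>S\<close>. A strategy for player II maps the finite list
  of the moves of player I made so far to the answer of player II. It wins if player II never is the
  first to break the rules, and every infinite play following the rules ends in the winning set.
\<close>

definition legal_I :: "'a set set \<Rightarrow> (nat \<Rightarrow> 'a set) \<Rightarrow> (nat \<Rightarrow> 'a set) \<Rightarrow> nat \<Rightarrow> bool" where
  "legal_I S X Y n \<longleftrightarrow> X n \<in> S \<and> (case n of 0 \<Rightarrow> {} | Suc m \<Rightarrow> Y m) \<subseteq> X n"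

definition legal_II :: "'a set set \<Rightarrow> (nat \<Rightarrow> 'a set) \<Rightarrow> (nat \<Rightarrow> 'a set) \<Rightarrow> nat \<Rightarrow> bool" where
  "legal_II S X Y n \<longleftrightarrow> X n \<subseteq> Y n \<and> Y n \<in> S"

definition answers :: "('a set list \<Rightarrow> 'a set) \<Rightarrow> (nat \<Rightarrow> 'a set) \<Rightarrow> nat \<Rightarrow> 'a set" where
  "answers \<sigma> X n = \<sigma> (map X [0..<Suc n])"

definition winning_strategy_II ::
  "('a set \<times> 'a set) set \<Rightarrow> 'a set set \<Rightarrow> 'a set \<Rightarrow> 'a set \<Rightarrow> ('a set list \<Rightarrow> 'a set) \<Rightarrow> bool" where
  "winning_strategy_II F S A B \<sigma> \<longleftrightarrow> (\<forall>X.
     (\<forall>n. (\<forall>m\<le>n. legal_I S X (answers \<sigma> X) m) \<longrightarrow> legal_II S X (answers \<sigma> X) n) \<and>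
     ((\<forall>n. legal_I S X (answers \<sigma> X) n) \<longrightarrow>
        (B \<union> (\<Union>n. answers \<sigma> X n), A \<union> (\<Union>n. answers \<sigma> X n)) \<in> F))"

end

theory Submission
  imports Defs
begin

text \<open>
  Sets \<open>stage n i\<close> of cardinality \<open>L i\<close> are built by recursion on \<open>n < \<omega>\<close>, simultaneously for all
  \<open>i < \<kappa>\<close>. Starting from the empty set, \<open>stage (n+1) i\<close> is obtained, through \<open>g i\<close> if \<open>i\<close> is a
  successor, from a set that absorbs: \<open>stage n j\<close> for \<open>j \<le> i\<close>; the part of \<open>stage n j\<close> enumerated
  below \<open>L i\<close>, for each limit \<open>j > i\<close>; and the answers of player II in the games on
  \<open>stage k (i+1) \<subseteq> stage (k+1) (i+1)\<close>, \<open>k < n\<close>, in which player I plays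
  \<open>stage (k+1) i, stage (k+2) i, \<dots>\<close>. The unions \<open>stage_union i\<close> over \<open>n\<close> then form a continuous
  chain, and \<open>stage k (i+1) \<union> stage_union i\<close> is the set at position \<open>\<omega> i + k\<close>: moving from \<open>k\<close> to
  \<open>k+1\<close> stays in \<open>F\<close> because all of these plays are won by player II.
\<close>

section \<open>Ordinal arithmetic\<close>

lemma AboveS_singleton: "i \<in> Field r \<Longrightarrow> AboveS r {i} = aboveS r i"
  by (auto simp: AboveS_def aboveS_def Field_def)

lemma
  assumes "Well_order r" "i \<in> Field r" "aboveS r i \<noteq> {}"
  shows ord_succ_greater: "(i, ord_succ r i) \<in> r" "i \<noteq> ord_succ r i"
    and ord_succ_in_Field: "ord_succ r i \<in> Field r"
proof -
  interpret wo: wo_rel r using assms by (simp add: wo_rel_def)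
  show "(i, ord_succ r i) \<in> r" "i \<noteq> ord_succ r i"
    using wo.suc_greater[of "{i}" i] assms by (auto simp: AboveS_singleton ord_succ_def)
  then show "ord_succ r i \<in> Field r" by (auto simp: Field_def)
qed

lemma ord_succ_least:
  assumes "Well_order r" "(i, a) \<in> r" "i \<noteq> a"
  shows "(ord_succ r i, a) \<in> r"
proof -
  interpret wo: wo_rel r using assms by (simp add: wo_rel_def)
  have "a \<in> AboveS r {i}" using assms by (auto simp: AboveS_def Field_def)
  then show ?thesis unfolding ord_succ_def by (rule wo.suc_least_AboveS)
qed

lemma ord_succ_eqI:
  assumes "Well_order r" "(i, a) \<in> r" "i \<noteq> a"
    and "\<And>b. (i, b) \<in> r \<Longrightarrow> i \<noteq> b \<Longrightarrow> (a, b) \<in> r"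
  shows "ord_succ r i = a"
proof -
  interpret wo: wo_rel r using assms by (simp add: wo_rel_def)
  show ?thesis unfolding ord_succ_def
    by (rule wo.equals_suc_AboveS[symmetric]) (use assms in \<open>auto simp: AboveS_def Field_def\<close>)
qed

lemma ord_zero_eqI:
  assumes "Well_order r" "z \<in> Field r" "\<And>b. b \<in> Field r \<Longrightarrow> (z, b) \<in> r"
  shows "ord_zero r = z"
proof -
  interpret wo: wo_rel r using assms by (simp add: wo_rel_def)
  show ?thesis unfolding ord_zero_def using wo.equals_minim[of "Field r" z] assms by auto
qed

lemma ord_zero_least:
  assumes "Well_order r" "b \<in> Field r"
  shows "(ord_zero r, b) \<in> r"
proof -
  interpret wo: wo_rel r using assms by (simp add: wo_rel_def)
  show ?thesis unfolding ord_zero_def using assms wo.minim_least[of "Field r"] by auto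
qed

lemma Field_ord_prod:
  assumes "Well_order r" "Well_order s"
  shows "Field (ord_prod r s) = Field r \<times> Field s"
proof -
  have "(k, k) \<in> r" if "k \<in> Field r" for k
    using assms(1) that wo_rel.REFL[of r] by (auto simp: wo_rel_def refl_on_def)
  then show ?thesis by (fastforce simp: ord_prod_def Field_def)
qed

lemma Well_order_ord_prod:
  assumes "Well_order r" "Well_order s"
  shows "Well_order (ord_prod r s)"
proof -
  interpret r: wo_rel r using assms by (simp add: wo_rel_def)
  interpret s: wo_rel s using assms by (simp add: wo_rel_def)
  let ?p = "ord_prod r s"
  have F: "Field ?p = Field r \<times> Field s" by (rule Field_ord_prod[OF assms])
  have "Refl ?p"
    unfolding refl_on_def F using r.REFL by (auto simp: ord_prod_def refl_on_def)
  moreover have "trans ?p"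
    using r.TRANS s.TRANS s.ANTISYM unfolding trans_def antisym_def ord_prod_def by blast
  moreover have "antisym ?p"
    using r.ANTISYM s.ANTISYM unfolding antisym_def ord_prod_def by blast
  moreover have "Total ?p"
    unfolding total_on_def F using r.TOTALS s.TOTALS by (auto simp: ord_prod_def)
  \<comment> \<open>The dominant coordinate of a pair is the second one, so the strict order embeds
    into a lexicographic product after \<open>prod.swap\<close>.\<close>
  moreover have "wf (?p - Id)"
  proof (rule wf_subset)
    show "wf (inv_image ((s - Id) <*lex*> (r - Id)) prod.swap)"
      using r.WF s.WF by auto
    show "?p - Id \<subseteq> inv_image ((s - Id) <*lex*> (r - Id)) prod.swap"
      by (auto simp: ord_prod_def)
  qed
  ultimately show ?thesis
    by (auto simp: order_on_defs intro: FieldI1 FieldI2)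
qed

text \<open>\<open>cofinal\<close> is strict: every element of the field lies strictly below some
  member of \<open>K\<close>. A finite nonempty \<open>K\<close> has a maximal element, and no
  member of \<open>K\<close> can lie strictly above it.\<close>

lemma infinite_cofinal:
  assumes "Well_order r" "Field r \<noteq> {}" "K \<subseteq> Field r" "cofinal K r"
  shows "infinite K"
proof
  assume fin: "finite K"
  interpret wo: wo_rel r using assms by (simp add: wo_rel_def)
  have "K \<noteq> {}" using assms by (auto simp: cofinal_def)
  have "wf ((r - Id)\<inverse> \<inter> K \<times> K)"
  proof (rule finite_acyclic_wf)
    have "acyclic ((r - Id)\<inverse>)"
      unfolding acyclic_converse using wo.WF by (rule wf_acyclic)
    then show "acyclic ((r - Id)\<inverse> \<inter> K \<times> K)"
      by (rule acyclic_subset) (rule Int_lower1)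
  qed (use fin in auto)
  then obtain m where m: "m \<in> K" "\<And>y. (y, m) \<in> (r - Id)\<inverse> \<inter> K \<times> K \<Longrightarrow> y \<notin> K"
    using \<open>K \<noteq> {}\<close> by (rule wfE_min') (rule that)
  obtain b where "b \<in> K" "m \<noteq> b" "(m, b) \<in> r"
    using assms(3,4) m(1) unfolding cofinal_def by blast
  then show False using m(1) m(2)[of b] by auto
qed

section \<open>Exhausting a set along a continuous sequence of cardinals\<close>

text \<open>Each \<open>L k\<close> is isomorphic to a proper initial segment of \<open>L j\<close>,
  and the assumption \<open>least\<close> makes these segments cover \<open>L j\<close>. An
  injection of \<open>A\<close> into \<open>Field (L j)\<close> pulls the cover back to
  \<open>A\<close>.\<close>

lemma ex_pieces:
  fixes L :: "'k \<Rightarrow> 'c rel"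
  assumes card: "\<And>k. k \<in> insert j K \<Longrightarrow> Card_order (L k)"
    and less: "\<And>k. k \<in> K \<Longrightarrow> L k <o L j"
    and least: "\<And>u :: 'c rel. Well_order u \<Longrightarrow> (\<And>k. k \<in> K \<Longrightarrow> L k \<le>o u) \<Longrightarrow> L j \<le>o u"
    and A: "|A| \<le>o L j"
  shows "\<exists>e. (\<forall>k\<in>K. |e k| \<le>o L k) \<and> A = (\<Union>k\<in>K. e k)"
proof -
  let ?seg = "underS (L j)"
  have wo: "Well_order (L k)" if "k \<in> insert j K" for k
    using card[OF that] by (simp add: card_order_on_well_order_on)
  then interpret wo: wo_rel "L j" by (simp add: wo_rel_def)
  have "\<exists>a. a \<in> Field (L j) \<and> L k =o Restr (L j) (?seg a)" if "k \<in> K" for k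
    using less[OF that] ordLess_iff_ordIso_Restr[of "L j" "L k"] wo that by auto
  then obtain a where a: "\<And>k. k \<in> K \<Longrightarrow> a k \<in> Field (L j)"
    "\<And>k. k \<in> K \<Longrightarrow> L k =o Restr (L j) (?seg (a k))"
    by metis
  have small: "|?seg (a k)| \<le>o L k" if "k \<in> K" for k
  proof -
    have "Field (Restr (L j) (?seg (a k))) = ?seg (a k)"
      using wo wo.underS_ofilter by (simp add: Field_Restr_ofilter)
    then have "|?seg (a k)| =o |Field (L k)|"
      using card_of_cong[OF a(2)[OF that]] by (simp add: ordIso_symmetric)
    then show ?thesis
      using card_of_Field_ordIso[OF card, of k] that by (auto intro: ordIso_transitive ordIso_imp_ordLeq)
  qed
  have cover: "\<exists>k\<in>K. x \<in> ?seg (a k)" if x: "x \<in> Field (L j)" for x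
  proof (rule ccontr)
    assume no: "\<not> ?thesis"
    \<comment> \<open>If \<open>x\<close> escaped all segments, the segment below \<open>x\<close>
      would be an upper bound of all \<open>L k\<close> shorter than \<open>L j\<close>.\<close>
    have "L k \<le>o Restr (L j) (?seg x)" if k: "k \<in> K" for k
    proof -
      have "x \<notin> ?seg (a k)" using no k by blast
      then have "(a k, x) \<in> L j"
        using x a(1)[OF k] wo.TOTALS wo.REFL by (auto simp: underS_def refl_on_def)
      then have "?seg (a k) \<subseteq> ?seg x"
        using wo.TRANS wo.ANTISYM unfolding underS_def trans_def antisym_def by blast
      then have "Restr (L j) (?seg (a k)) \<le>o Restr (L j) (?seg x)"
        using ofilter_subset_ordLeq[of "L j" "?seg (a k)" "?seg x"] wo wo.underS_ofilter by auto
      then show ?thesis using a(2)[OF k] ordIso_ordLeq_trans by blast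
    qed
    then have "L j \<le>o Restr (L j) (?seg x)"
      by (intro least Well_order_Restr wo) auto
    moreover have "Restr (L j) (?seg x) <o L j"
      using underS_Restr_ordLess[of "L j"] wo x by auto
    ultimately show False using not_ordLess_ordLeq by blast
  qed
  have "|A| \<le>o |Field (L j)|"
    using A card_of_Field_ordIso[OF card, of j] ordIso_symmetric ordLeq_ordIso_trans by blast
  then obtain f where f: "inj_on f A" "f ` A \<subseteq> Field (L j)"
    unfolding card_of_ordLeq[symmetric] by blast
  let ?e = "\<lambda>k. {x \<in> A. f x \<in> ?seg (a k)}"
  have "|?e k| \<le>o L k" if "k \<in> K" for k
  proof -
    have "|?e k| \<le>o |?seg (a k)|"
    proof (rule card_of_ordLeqI)
      show "inj_on f (?e k)" using f(1) by (rule inj_on_subset) blast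
    qed blast
    then show ?thesis by (rule ordLeq_transitive[OF _ small[OF that]])
  qed
  moreover have "A = (\<Union>k\<in>K. ?e k)" using cover f by blast
  ultimately show ?thesis by (intro exI[of _ ?e]) auto
qed

section \<open>The game\<close>

text \<open>The moves of player I are fixed in advance, so legality has to be proved along the play:
  legal moves up to \<open>n\<close> make the answer at \<open>n\<close> legal, hence a member of
  \<open>S\<close>, and \<open>step\<close> then makes the next move legal. Moves and answers
  interleave, so both have the same union.\<close>

lemma winning_strategy_II_UN:
  assumes win: "winning_strategy_II F S A B \<sigma>"
    and X: "\<And>n. X n \<in> S"
    and step: "\<And>n. answers \<sigma> X n \<in> S \<Longrightarrow> answers \<sigma> X n \<subseteq> X (Suc n)"
  shows "(B \<union> (\<Union>n. X n), A \<union> (\<Union>n. X n)) \<in> F"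
proof -
  let ?Y = "answers \<sigma> X"
  have reply: "legal_II S X ?Y n" if "\<And>m. m \<le> n \<Longrightarrow> legal_I S X ?Y m" for n
    using win that unfolding winning_strategy_II_def by blast
  have legal: "\<forall>m\<le>n. legal_I S X ?Y m" for n
  proof (induction n)
    case 0
    then show ?case using X by (simp add: legal_I_def)
  next
    case (Suc n)
    then have "?Y n \<subseteq> X (Suc n)" using reply step by (auto simp: legal_II_def)
    with Suc X show ?case by (auto simp: le_Suc_eq legal_I_def)
  qed
  then have "legal_II S X ?Y n" for n using reply by blast
  then have "X n \<subseteq> ?Y n" "?Y n \<subseteq> X (Suc n)" for n
    using step by (auto simp: legal_II_def)
  then have "(\<Union>n. ?Y n) = (\<Union>n. X n)" by blast
  then show ?thesis using win legal unfolding winning_strategy_II_def by fastforce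
qed

section \<open>The construction\<close>

text \<open>The decomposition of \<open>lam\<close> as a sum enters through the sets
  \<open>P i\<close>. They give every positive stage its full cardinality and make the stages
  exhaust \<open>lam\<close>.\<close>

locale singular_filtration =
  fixes lam :: "'a rel" and kappa :: "'k rel" and L :: "'k \<Rightarrow> 'c rel"
    and F :: "('a set \<times> 'a set) set"
    and g :: "'k \<Rightarrow> 'a set \<times> 'a set \<Rightarrow> 'a set"
    and P :: "'k \<Rightarrow> 'a set"
  assumes kappa_card: "Card_order kappa"
    and kappa_inf: "infinite (Field kappa)"
    and L_card: "i \<in> Field kappa \<Longrightarrow> Card_order (L i)"
    and L_incr: "card_increasing kappa L"
    and L_cont: "card_continuous kappa L"
    and L_zero: "L (ord_zero kappa) =o (czero :: 'c rel)"
    and L_one: "kappa \<le>o L (ord_succ kappa (ord_zero kappa))"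
    and P_card: "i \<in> Field kappa \<Longrightarrow> |P i| =o L i"
    and P_cover: "Field lam = (\<Union>i\<in>Field kappa. P i)"
    and g_maps: "i \<in> Field kappa \<Longrightarrow> is_succ kappa i \<Longrightarrow>
      g i \<in> subsets_of_card0 lam (L i) \<times> subsets_of_card0 lam (L i) \<rightarrow> subsets_of_card0 lam (L i)"
    and hyp_I: "\<lbrakk>i \<in> Field kappa; is_succ kappa i;
        A1 \<in> subsets_of_card0 lam (L i); A2 \<in> subsets_of_card0 lam (L i); A1 \<subseteq> A2;
        A1 \<in> {{}} \<union> g i ` (subsets_of_card0 lam (L i) \<times> subsets_of_card0 lam (L i))\<rbrakk>
      \<Longrightarrow> A2 \<subseteq> g i (A1, A2) \<and> (g i (A1, A2), A1) \<in> F"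
    and hyp_II: "\<lbrakk>i \<in> Field kappa; i' = ord_succ kappa i;
        A \<in> subsets_of_card0 lam (L i'); B \<in> subsets_of_card0 lam (L i'); A \<subseteq> B; (B, A) \<in> F;
        B \<in> g i' ` (subsets_of_card0 lam (L i') \<times> subsets_of_card0 lam (L i'))\<rbrakk>
      \<Longrightarrow> \<exists>\<sigma>. winning_strategy_II F (subsets_of_card lam (L i)) A B \<sigma>"
begin

abbreviation "S i \<equiv> subsets_of_card lam (L i)"
abbreviation "S0 i \<equiv> subsets_of_card0 lam (L i)"
abbreviation "next_ord \<equiv> ord_succ kappa"

definition pieces :: "'a set \<Rightarrow> 'k \<Rightarrow> 'k \<Rightarrow> 'a set" where
  "pieces A j = (SOME e. (\<forall>k\<in>underS kappa j. |e k| \<le>o L k) \<and> A = (\<Union>k\<in>underS kappa j. e k))"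

text \<open>The choice depends on \<open>i\<close>, \<open>A\<close>, \<open>B\<close> alone, so all
  stages consult the same strategy in the game on a given pair, and their answers fit together into
  one play.\<close>

definition strategy :: "'k \<Rightarrow> 'a set \<Rightarrow> 'a set \<Rightarrow> 'a set list \<Rightarrow> 'a set" where
  "strategy i A B = (SOME \<sigma>. winning_strategy_II F (S i) A B \<sigma>)"

text \<open>
  Illegal answers are discarded, so that the size of the stages can be controlled before the plays
  are known to be legal.
\<close>

definition answer :: "'k \<Rightarrow> 'a set \<Rightarrow> 'a set \<Rightarrow> 'a set list \<Rightarrow> 'a set" where
  "answer i A B Xs = (if strategy i A B Xs \<in> S i then strategy i A B Xs else {})"

text \<open>Every stage number on the right is at most \<open>n\<close>; this is why larger indices
  \<open>j\<close> may be consulted without circularity. In the game for \<open>k\<close>, the list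
  holds the moves made so far, from \<open>stage (Suc k) i\<close> up to
  \<open>stage n i\<close>.\<close>

fun stage :: "nat \<Rightarrow> 'k \<Rightarrow> 'a set" where
  "stage 0 i = {}"
| "stage (Suc n) i =
    (let X = P i \<union> stage n i \<union> (\<Union>j\<in>underS kappa i. stage n j)
       \<union> (\<Union>j\<in>{j. is_limit kappa j \<and> i \<in> underS kappa j}. pieces (stage n j) j i)
       \<union> (\<Union>k\<in>{..<n}. answer i (stage k (next_ord i)) (stage (Suc k) (next_ord i))
            (map (\<lambda>m. stage m i) [Suc k..<Suc n]))
     in if is_succ kappa i then g i (stage n i, X) else X)"

text \<open>The right-hand side contains \<open>stage (Suc k)\<close> for a bound \<open>k\<close>, so that rewriting would not terminate.\<close>

declare stage.simps(2) [simp del]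

definition absorb :: "nat \<Rightarrow> 'k \<Rightarrow> 'a set" where
  "absorb n i = P i \<union> stage n i \<union> (\<Union>j\<in>underS kappa i. stage n j)
     \<union> (\<Union>j\<in>{j. is_limit kappa j \<and> i \<in> underS kappa j}. pieces (stage n j) j i)
     \<union> (\<Union>k\<in>{..<n}. answer i (stage k (next_ord i)) (stage (Suc k) (next_ord i))
          (map (\<lambda>m. stage m i) [Suc k..<Suc n]))"

lemma stage_Suc:
  "stage (Suc n) i = (if is_succ kappa i then g i (stage n i, absorb n i) else absorb n i)"
  unfolding absorb_def by (subst stage.simps(2)) (simp only: Let_def)

section \<open>The index ordinal and the cardinals \<open>L i\<close>\<close>

lemma Well_kappa: "Well_order kappa"
  using kappa_card by (simp add: card_order_on_well_order_on)

sublocale wo: wo_rel kappa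
  using Well_kappa by (simp add: wo_rel_def)

lemma aboveS_nonempty: "i \<in> Field kappa \<Longrightarrow> aboveS kappa i \<noteq> {}"
  using infinite_Card_order_limit[OF kappa_card kappa_inf, of i] by (auto simp: aboveS_def)

lemma next_ord:
  assumes "i \<in> Field kappa"
  shows "(i, next_ord i) \<in> kappa" "i \<noteq> next_ord i" "next_ord i \<in> Field kappa"
  using ord_succ_greater[OF Well_kappa assms aboveS_nonempty[OF assms]]
    ord_succ_in_Field[OF Well_kappa assms aboveS_nonempty[OF assms]] by auto

lemma is_succ_next_ord: "i \<in> Field kappa \<Longrightarrow> is_succ kappa (next_ord i)"
  using aboveS_nonempty by (auto simp: is_succ_def)

lemma zero_in_Field: "ord_zero kappa \<in> Field kappa"
proof -
  have "Field kappa \<noteq> {}" using kappa_inf by auto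
  then show ?thesis using ord_zero_least[OF Well_kappa] by (auto simp: Field_def)
qed

lemma L_mono: "(i, j) \<in> kappa \<Longrightarrow> L i \<le>o L j"
proof (cases "i = j")
  case True
  moreover assume "(i, j) \<in> kappa"
  ultimately have "Card_order (L i)" by (intro L_card) (auto simp: Field_def)
  then have "L i \<le>o L i" by (simp add: card_order_on_well_order_on ordLeq_reflexive)
  with True show ?thesis by simp
next
  case False
  moreover assume "(i, j) \<in> kappa"
  ultimately show ?thesis using L_incr by (auto simp: card_increasing_def intro: ordLess_imp_ordLeq)
qed

lemma kappa_le_L:
  assumes "i \<in> Field kappa" "i \<noteq> ord_zero kappa"
  shows "kappa \<le>o L i"
proof -
  have "(next_ord (ord_zero kappa), i) \<in> kappa"
    using assms ord_succ_least[OF Well_kappa] ord_zero_least[OF Well_kappa] by auto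
  then show ?thesis by (rule ordLeq_transitive[OF L_one L_mono])
qed

lemma infinite_L: "i \<in> Field kappa \<Longrightarrow> i \<noteq> ord_zero kappa \<Longrightarrow> infinite (Field (L i))"
  using card_of_ordLeq_infinite[OF card_of_mono2[OF kappa_le_L] kappa_inf] .

section \<open>Closure properties of sets of cardinality at most \<open>L i\<close>\<close>

lemma small_zero: "|A| \<le>o L (ord_zero kappa) \<Longrightarrow> A = {}"
proof -
  assume "|A| \<le>o L (ord_zero kappa)"
  then have "|A| \<le>o (czero :: 'c rel)" using L_zero by (rule ordLeq_ordIso_trans)
  then show "A = {}" by (simp add: czero_def card_of_empty3)
qed

lemma small_empty: "i \<in> Field kappa \<Longrightarrow> |{}| \<le>o L i"
  using card_of_empty1 L_card by blast

text \<open>At a nonzero index \<open>L i\<close> is infinite and at least \<open>kappa\<close>, so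
  it absorbs unions of \<open>kappa\<close> many sets. At index zero all the sets are empty.\<close>

lemma small_UN:
  assumes "i \<in> Field kappa" "|I| \<le>o kappa" "\<And>j. j \<in> I \<Longrightarrow> |A j| \<le>o L i"
  shows "|\<Union>j\<in>I. A j| \<le>o L i"
proof (cases "i = ord_zero kappa")
  case True
  then have "(\<Union>j\<in>I. A j) = {}" using assms small_zero by auto
  then show ?thesis using small_empty[OF assms(1)] by simp
next
  case False
  show ?thesis
    using assms(3) by (intro card_of_UNION_ordLeq_infinite_Field[OF infinite_L L_card]
        ordLeq_transitive[OF assms(2) kappa_le_L] assms(1) False) blast
qed

lemma small_Un:
  assumes "i \<in> Field kappa" "|A| \<le>o L i" "|B| \<le>o L i"
  shows "|A \<union> B| \<le>o L i"
proof (cases "i = ord_zero kappa")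
  case True
  then have "A \<union> B = {}" using assms small_zero by auto
  then show ?thesis using small_empty[OF assms(1)] by simp
next
  case False
  then show ?thesis
    using card_of_Un_ordLeq_infinite_Field[OF infinite_L _ _ L_card] assms by blast
qed

lemma card_subset_kappa: "I \<subseteq> Field kappa \<Longrightarrow> |I| \<le>o kappa"
  using ordLeq_ordIso_trans[OF card_of_mono1 card_of_Field_ordIso[OF kappa_card]] .

lemma card_finite_kappa: "finite I \<Longrightarrow> |I| \<le>o kappa"
  by (rule ordLess_imp_ordLeq, rule finite_ordLess_infinite[OF card_of_Well_order Well_kappa])
    (simp_all add: Field_card_of kappa_inf)

text \<open>Continuity of \<open>L\<close> at \<open>j\<close> is the minimality that
  \<open>ex_pieces\<close> asks for.\<close>

lemma pieces:
  assumes "is_limit kappa j" "|A| \<le>o L j"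
  shows "k \<in> underS kappa j \<Longrightarrow> |pieces A j k| \<le>o L k"
    and "A = (\<Union>k\<in>underS kappa j. pieces A j k)"
proof -
  have "\<exists>e. (\<forall>k\<in>underS kappa j. |e k| \<le>o L k) \<and> A = (\<Union>k\<in>underS kappa j. e k)"
  proof (rule ex_pieces)
    show "Card_order (L k)" if "k \<in> insert j (underS kappa j)" for k
      using that assms(1) L_card by (auto simp: is_limit_def underS_def Field_def)
    show "L k <o L j" if "k \<in> underS kappa j" for k
      using that L_incr by (auto simp: underS_def card_increasing_def)
    show "L j \<le>o u" if "Well_order u" "\<And>k. k \<in> underS kappa j \<Longrightarrow> L k \<le>o u" for u :: "'c rel"
      using that L_cont assms(1) unfolding card_continuous_def by blast
  qed (fact assms(2))
  from someI_ex[OF this] show "k \<in> underS kappa j \<Longrightarrow> |pieces A j k| \<le>o L k"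
    and "A = (\<Union>k\<in>underS kappa j. pieces A j k)"
    unfolding pieces_def by blast+
qed

text \<open>Splits membership into an upper and a lower bound. With \<open>P i\<close> in place of
  \<open>L i\<close>, the lower bound follows from an inclusion.\<close>

lemma in_S_iff:
  assumes "i \<in> Field kappa"
  shows "A \<in> S i \<longleftrightarrow> A \<subseteq> Field lam \<and> |A| \<le>o L i \<and> |P i| \<le>o |A|"
proof -
  have P: "|P i| \<le>o L i" "L i \<le>o |P i|"
    using P_card[OF assms] by (simp_all add: ordIso_iff_ordLeq)
  have "L i \<le>o |A| \<longleftrightarrow> |P i| \<le>o |A|"
    using ordLeq_transitive[OF P(1), of "|A|"] ordLeq_transitive[OF P(2), of "|A|"] by blast
  then show ?thesis by (auto simp: subsets_of_card_def ordIso_iff_ordLeq)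
qed

section \<open>Cardinality and growth of the stages\<close>

lemma S0_D:
  assumes "i \<in> Field kappa" "A \<in> S0 i"
  shows "A \<subseteq> Field lam" "|A| \<le>o L i"
  using assms small_empty[OF assms(1)]
  by (auto simp: subsets_of_card0_def subsets_of_card_def intro: ordIso_imp_ordLeq)

text \<open>Containing \<open>P i\<close> gives the lower bound. For the upper bound,
  \<open>absorb n i\<close> is built from at most \<open>kappa\<close> many sets of size at most
  \<open>L i\<close>: a stage with \<open>j\<close> above \<open>i\<close> may be larger, but only
  its piece at \<open>i\<close> is taken.\<close>

lemma absorb_S:
  assumes S0: "\<And>j. j \<in> Field kappa \<Longrightarrow> stage n j \<in> S0 j" and i: "i \<in> Field kappa"
  shows "absorb n i \<in> S i"
proof -
  have less: "j \<in> Field kappa" "(j, i) \<in> kappa" if "j \<in> underS kappa i" for j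
    using that by (auto simp: underS_def Field_def)
  have lim: "j \<in> Field kappa" "|stage n j| \<le>o L j" if "is_limit kappa j" for j
    using that S0 S0_D by (auto simp: is_limit_def)
  have sub: "pieces (stage n j) j i \<subseteq> Field lam"
    if j: "is_limit kappa j" "i \<in> underS kappa j" for j
  proof -
    have "pieces (stage n j) j i \<subseteq> stage n j"
      using pieces(2)[OF j(1) lim(2)[OF j(1)]] j(2) by blast
    also have "\<dots> \<subseteq> Field lam" using S0_D S0 lim(1)[OF j(1)] by blast
    finally show ?thesis .
  qed
  have ans: "answer i A B Xs \<subseteq> Field lam" "|answer i A B Xs| \<le>o L i" for A B Xs
    using S0_D[OF i, of "answer i A B Xs"] by (auto simp: answer_def subsets_of_card0_def)
  have st: "|stage n j| \<le>o L i" if "j \<in> underS kappa i" for j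
    using ordLeq_transitive[OF S0_D(2)[OF _ S0] L_mono] less[OF that] by blast
  have "absorb n i \<subseteq> Field lam"
    using S0_D[OF _ S0] i less sub ans P_cover unfolding absorb_def by blast
  moreover have "|absorb n i| \<le>o L i"
    unfolding absorb_def
    by (intro small_Un small_UN i card_subset_kappa card_finite_kappa ans(2) st
        pieces(1) lim ordIso_imp_ordLeq[OF P_card] S0_D(2)[OF i S0])
      (use underS_Field lim in auto)
  moreover have "|P i| \<le>o |absorb n i|"
    unfolding absorb_def by (intro card_of_mono1) blast
  ultimately show ?thesis using in_S_iff[OF i] by blast
qed

lemma stage_S0: "i \<in> Field kappa \<Longrightarrow> stage n i \<in> S0 i"
proof (induction n arbitrary: i)
  case 0
  then show ?case by (simp add: subsets_of_card0_def)
next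
  case (Suc n)
  have "absorb n i \<in> S0 i"
    using absorb_S[OF Suc.IH Suc.prems] by (simp add: subsets_of_card0_def)
  then have "(stage n i, absorb n i) \<in> S0 i \<times> S0 i" using Suc by blast
  then have "is_succ kappa i \<Longrightarrow> g i (stage n i, absorb n i) \<in> S0 i"
    using g_maps[OF Suc.prems] funcset_mem by blast
  then show ?case using \<open>absorb n i \<in> S0 i\<close> by (simp add: stage_Suc)
qed

lemma absorb_in_S: "i \<in> Field kappa \<Longrightarrow> absorb n i \<in> S i"
  by (rule absorb_S[OF stage_S0])

lemma absorb_in_S0: "i \<in> Field kappa \<Longrightarrow> absorb n i \<in> S0 i"
  unfolding subsets_of_card0_def by (rule UnI1[OF absorb_in_S])

lemma stage_le_absorb: "stage n i \<subseteq> absorb n i"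
  by (auto simp: absorb_def)

text \<open>This is the range condition of Hypothesis I, which allows \<open>g i\<close> to be
  applied again at the next stage.\<close>

lemma stage_in_range:
  assumes "i \<in> Field kappa" "is_succ kappa i"
  shows "stage n i \<in> {{}} \<union> g i ` (S0 i \<times> S0 i)"
proof (cases n)
  case (Suc m)
  then show ?thesis
    using assms(2) stage_S0[OF assms(1), of m] absorb_in_S0[OF assms(1), of m]
    unfolding Suc stage_Suc by (metis SigmaI UnI2 imageI)
qed simp

lemma absorb_le_stage: "i \<in> Field kappa \<Longrightarrow> absorb n i \<subseteq> stage (Suc n) i"
  using hyp_I[OF _ _ stage_S0 absorb_in_S0 stage_le_absorb stage_in_range, of i]
  by (simp add: stage_Suc)

lemma stage_F:
  assumes "i \<in> Field kappa" "is_succ kappa i"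
  shows "(stage (Suc n) i, stage n i) \<in> F"
  using hyp_I[OF _ _ stage_S0 absorb_in_S0 stage_le_absorb stage_in_range, of i] assms
  by (simp add: stage_Suc)

lemma stage_mono: "i \<in> Field kappa \<Longrightarrow> m \<le> n \<Longrightarrow> stage m i \<subseteq> stage n i"
  by (rule lift_Suc_mono_le[of "\<lambda>n. stage n i", OF order_trans[OF stage_le_absorb absorb_le_stage]])

text \<open>Positive stages include \<open>P i\<close> by way of \<open>absorb n i\<close>, so they
  can serve as moves in the game.\<close>

lemma stage_Suc_in_S:
  assumes "i \<in> Field kappa"
  shows "stage (Suc n) i \<in> S i"
proof -
  have "|P i| \<le>o |absorb n i|" using absorb_in_S[OF assms] in_S_iff[OF assms] by blast
  also have "|absorb n i| \<le>o |stage (Suc n) i|"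
    using absorb_le_stage[OF assms] by (rule card_of_mono1)
  finally show ?thesis using in_S_iff[OF assms] S0_D[OF assms stage_S0[OF assms]] by blast
qed

section \<open>The unions of the stages form a continuous chain\<close>

definition stage_union :: "'k \<Rightarrow> 'a set" where
  "stage_union i = (\<Union>n. stage n i)"

lemma stage_le_union: "stage n i \<subseteq> stage_union i"
  by (auto simp: stage_union_def)

lemma absorb_le_union: "i \<in> Field kappa \<Longrightarrow> absorb n i \<subseteq> stage_union i"
  using absorb_le_stage stage_le_union by blast

lemma stage_union_mono:
  assumes "(i, j) \<in> kappa"
  shows "stage_union i \<subseteq> stage_union j"
proof (cases "i = j")
  case False
  then have i: "i \<in> underS kappa j" and j: "j \<in> Field kappa"
    using assms by (auto simp: underS_def Field_def)
  have "stage n i \<subseteq> stage_union j" for n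
    using absorb_le_union[OF j, of n] i by (auto simp: absorb_def)
  then show ?thesis by (auto simp: stage_union_def)
qed simp

text \<open>For the nontrivial inclusion, \<open>stage n j\<close> is the union of its pieces, and
  the piece at \<open>k\<close> below \<open>j\<close> was absorbed by
  \<open>stage (Suc n) k\<close>.\<close>

lemma stage_union_limit:
  assumes j: "is_limit kappa j"
  shows "stage_union j = (\<Union>k\<in>underS kappa j. stage_union k)"
proof
  show "(\<Union>k\<in>underS kappa j. stage_union k) \<subseteq> stage_union j"
    using stage_union_mono by (fastforce simp: underS_def)
  have "stage n j \<subseteq> (\<Union>k\<in>underS kappa j. stage_union k)" for n
  proof -
    have "j \<in> Field kappa" using j by (simp add: is_limit_def)
    then have "stage n j = (\<Union>k\<in>underS kappa j. pieces (stage n j) j k)"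
      by (intro pieces(2)[OF j] S0_D(2) stage_S0)
    moreover have "pieces (stage n j) j k \<subseteq> stage_union k" if "k \<in> underS kappa j" for k
    proof -
      have "k \<in> Field kappa" using that by (auto simp: underS_def Field_def)
      then show ?thesis using that j absorb_le_union[of k n] by (auto simp: absorb_def)
    qed
    ultimately show ?thesis by blast
  qed
  then show "stage_union j \<subseteq> (\<Union>k\<in>underS kappa j. stage_union k)"
    by (auto simp: stage_union_def)
qed

lemma stage_union_zero: "stage_union (ord_zero kappa) = {}"
  using S0_D(2)[OF zero_in_Field stage_S0[OF zero_in_Field]] small_zero
  by (auto simp: stage_union_def)

lemma stage_union_cover: "Field lam = (\<Union>i\<in>Field kappa. stage_union i)"
proof
  have "P i \<subseteq> stage_union i" if "i \<in> Field kappa" for i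
    using absorb_le_union[OF that, of 0] by (auto simp: absorb_def)
  then show "Field lam \<subseteq> (\<Union>i\<in>Field kappa. stage_union i)"
    unfolding P_cover by (intro UN_mono subset_refl)
  have "stage_union i \<subseteq> Field lam" if "i \<in> Field kappa" for i
    using S0_D(1)[OF that stage_S0[OF that]] by (auto simp: stage_union_def)
  then show "(\<Union>i\<in>Field kappa. stage_union i) \<subseteq> Field lam"
    by (rule UN_least)
qed

text \<open>The successive stages at \<open>i\<close> are the moves of player I in the game on
  \<open>stage k (next_ord i)\<close> and \<open>stage (Suc k) (next_ord i)\<close>. Player II wins
  this play, and the union of the moves is \<open>stage_union i\<close>.\<close>

lemma stage_union_F:
  assumes i: "i \<in> Field kappa"
  shows "(stage (Suc k) (next_ord i) \<union> stage_union i, stage k (next_ord i) \<union> stage_union i) \<in> F"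
proof -
  let ?A = "stage k (next_ord i)" and ?B = "stage (Suc k) (next_ord i)"
  \<comment> \<open>The play starts at a positive stage even for \<open>k = 0\<close>: the empty set
    \<open>stage 0 i\<close> is a legal move only if \<open>L i\<close> is zero.\<close>
  let ?X = "\<lambda>n. stage (Suc k + n) i"
  let ?\<sigma> = "strategy i ?A ?B"
  have i': "next_ord i \<in> Field kappa" "is_succ kappa (next_ord i)"
    using next_ord is_succ_next_ord i by auto
  have "\<exists>\<sigma>. winning_strategy_II F (S i) ?A ?B \<sigma>"
  proof (rule hyp_II[OF i refl])
    show "?B \<in> g (next_ord i) ` (S0 (next_ord i) \<times> S0 (next_ord i))"
      using stage_S0 absorb_in_S0 i' by (auto simp: stage_Suc)
  qed (use stage_S0 stage_F stage_mono[of _ k "Suc k"] i' in auto)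
  then have win: "winning_strategy_II F (S i) ?A ?B ?\<sigma>"
    unfolding strategy_def by (rule someI_ex)
  have "answers ?\<sigma> ?X n \<subseteq> ?X (Suc n)" if legal: "answers ?\<sigma> ?X n \<in> S i" for n
  proof -
    \<comment> \<open>The history of round \<open>n\<close> is the list evaluated in
      \<open>absorb (Suc k + n) i\<close>, so the answer lies in the following stage, which is the
      next move.\<close>
    have "map ?X [0..<Suc n] = map (\<lambda>m. stage m i) [Suc k..<Suc (Suc k + n)]"
      by (rule nth_equalityI) (auto simp del: upt_Suc)
    then have "answers ?\<sigma> ?X n
        = answer i ?A ?B (map (\<lambda>m. stage m i) [Suc k..<Suc (Suc k + n)])"
      using legal by (simp add: answers_def answer_def del: upt_Suc)
    also have "\<dots> \<subseteq> absorb (Suc k + n) i"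
      unfolding absorb_def by (rule le_supI2, rule order_trans[OF _ UN_upper[of k]]) auto
    also have "\<dots> \<subseteq> ?X (Suc n)" using absorb_le_stage[OF i, of "Suc k + n"] by simp
    finally show ?thesis .
  qed
  moreover have "?X n \<in> S i" for n using stage_Suc_in_S[OF i, of "k + n"] by simp
  ultimately have "(?B \<union> (\<Union>n. ?X n), ?A \<union> (\<Union>n. ?X n)) \<in> F"
    by (intro winning_strategy_II_UN[OF win])
  \<comment> \<open>The stages increase, so dropping the first \<open>Suc k\<close> of them does not
    change the union.\<close>
  moreover have "(\<Union>n. ?X n) = stage_union i"
  proof -
    have "stage n i \<subseteq> ?X n" for n using stage_mono[OF i, of n "Suc k + n"] by simp
    then show ?thesis unfolding stage_union_def by blast
  qed
  ultimately show ?thesis by simp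
qed

lemma next_ord_stage_le_union:
  "i \<in> Field kappa \<Longrightarrow> (i, j) \<in> kappa \<Longrightarrow> i \<noteq> j \<Longrightarrow> stage k (next_ord i) \<union> stage_union i \<subseteq> stage_union j"
  using stage_union_mono ord_succ_least[OF Well_kappa] stage_le_union by blast

section \<open>The ordinal product and the chain indexed by it\<close>

abbreviation "wk \<equiv> ord_prod natLeq kappa"

lemma Well_wk: "Well_order wk"
  by (rule Well_order_ord_prod) (auto simp: natLeq_Well_order Well_kappa)

lemma Field_wk: "Field wk = UNIV \<times> Field kappa"
  using Field_ord_prod[OF natLeq_Well_order Well_kappa] by (simp add: Field_natLeq)

lemma in_wk_iff: "((k, i), (l, j)) \<in> wk \<longleftrightarrow>
    i \<in> Field kappa \<and> j \<in> Field kappa \<and> ((i, j) \<in> kappa \<and> i \<noteq> j \<or> i = j \<and> k \<le> l)"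
proof -
  have "(k, l) \<in> natLeq \<longleftrightarrow> k \<le> l" by (simp add: natLeq_def)
  then show ?thesis by (auto simp: ord_prod_def Field_natLeq)
qed

lemma ord_succ_wk: "i \<in> Field kappa \<Longrightarrow> ord_succ wk (k, i) = (Suc k, i)"
  by (rule ord_succ_eqI[OF Well_wk]) (auto simp: in_wk_iff)

lemma ord_zero_wk: "ord_zero wk = (0, ord_zero kappa)"
  by (rule ord_zero_eqI[OF Well_wk])
    (auto simp: in_wk_iff Field_wk zero_in_Field ord_zero_least[OF Well_kappa])

text \<open>A position with positive first coordinate is the successor of its predecessor in the
  same copy of \<open>natLeq\<close>, so a limit must start a copy, and not the first one.\<close>

lemma is_limit_wkE:
  assumes "is_limit wk (k, i)"
  shows "k = 0" "i \<in> Field kappa" "i \<noteq> ord_zero kappa"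
proof -
  show i: "i \<in> Field kappa" using assms by (simp add: is_limit_def Field_wk)
  show "k = 0"
  proof (cases k)
    case (Suc l)
    have "(Suc l, i) \<in> aboveS wk (l, i)" using i by (auto simp: aboveS_def in_wk_iff)
    then have "is_succ wk (k, i)"
      unfolding is_succ_def using i Suc ord_succ_wk by (intro bexI[of _ "(l, i)"]) (auto simp: Field_wk)
    then show ?thesis using assms by (simp add: is_limit_def)
  qed simp
  then show "i \<noteq> ord_zero kappa" using assms by (auto simp: is_limit_def ord_zero_wk)
qed

lemma ex_chain:
  "\<exists>A :: nat \<times> 'k \<Rightarrow> 'a set.
      relChain wk A \<and> set_continuous wk A \<and> A (ord_zero wk) = {} \<and>
      Field lam = (\<Union>\<alpha>\<in>Field wk. A \<alpha>) \<and>
      (\<forall>\<alpha>\<in>Field wk. (A (ord_succ wk \<alpha>), A \<alpha>) \<in> F)"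
proof -
  define A where "A = (\<lambda>(k, i). stage k (next_ord i) \<union> stage_union i)"
  have A_le: "A (k, i) \<subseteq> stage_union j" if "i \<in> Field kappa" "(i, j) \<in> kappa" "i \<noteq> j" for k i j
    using next_ord_stage_le_union[OF that] by (simp add: A_def)
  have union_le: "stage_union i \<subseteq> A (k, i)" for k i
    by (simp add: A_def)
  have "A (k, i) \<subseteq> A (l, j)" if "((k, i), (l, j)) \<in> wk" for k i l j
  proof (cases "i = j")
    case True
    then have "i \<in> Field kappa" "k \<le> l" using that by (auto simp: in_wk_iff)
    then show ?thesis
      using True stage_mono[OF next_ord(3), of i k l] by (auto simp: A_def)
  next
    case False
    then show ?thesis using that A_le[of i j k] union_le[of j l] by (auto simp: in_wk_iff)
  qed
  then have "relChain wk A" by (auto simp: relChain_def)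
  moreover have "set_continuous wk A"
    unfolding set_continuous_def
  proof safe
    fix k i x
    assume lim: "is_limit wk (k, i)" and x: "x \<in> A (k, i)"
    note i = is_limit_wkE[OF lim]
    \<comment> \<open>Here \<open>k = 0\<close>, and \<open>stage 0\<close> contributes
      nothing.\<close>
    have "x \<in> stage_union i" using x i by (simp add: A_def)
    have "\<exists>l j. (j, i) \<in> kappa \<and> j \<noteq> i \<and> x \<in> A (l, j)"
    proof (cases "is_succ kappa i")
      case True
      \<comment> \<open>The copy of \<open>natLeq\<close> at \<open>j\<close> runs through all
        stages at \<open>next_ord j\<close>, so its sets exhaust
        \<open>stage_union i\<close>.\<close>
      then obtain j where j: "j \<in> Field kappa" "i = next_ord j" by (auto simp: is_succ_def)
      with \<open>x \<in> stage_union i\<close> obtain n where "x \<in> A (n, j)"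
        by (auto simp: stage_union_def A_def)
      with j next_ord show ?thesis by auto
    next
      \<comment> \<open>The index \<open>i\<close> is itself a limit, and continuity of
        \<open>stage_union\<close> applies.\<close>
      case False
      then have "is_limit kappa i" using i by (simp add: is_limit_def)
      then obtain j where "j \<in> underS kappa i" "x \<in> stage_union j"
        using stage_union_limit \<open>x \<in> stage_union i\<close> by auto
      then have "(j, i) \<in> kappa" "j \<noteq> i" "x \<in> A (0, j)"
        using union_le[of j 0] by (auto simp: underS_def)
      then show ?thesis by blast
    qed
    then obtain l j where lj: "(j, i) \<in> kappa" "j \<noteq> i" "x \<in> A (l, j)" by blast
    then have "(l, j) \<in> underS wk (k, i)"
      using i FieldI1[of j i kappa] by (auto simp: underS_def in_wk_iff)
    with lj show "x \<in> (\<Union>\<alpha>\<in>underS wk (k, i). A \<alpha>)" by blast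
  next
    fix k i x l j
    assume "(l, j) \<in> underS wk (k, i)" "x \<in> A (l, j)"
    then show "x \<in> A (k, i)"
      using \<open>relChain wk A\<close> unfolding underS_def relChain_def by blast
  qed
  moreover have "A (ord_zero wk) = {}"
    by (simp add: ord_zero_wk A_def stage_union_zero)
  moreover have "Field lam = (\<Union>\<alpha>\<in>Field wk. A \<alpha>)"
  proof -
    have "A (k, i) \<subseteq> Field lam" if "i \<in> Field kappa" for k i
      using A_le[OF that next_ord(1,2)[OF that]] next_ord(3)[OF that] stage_union_cover by blast
    then have "(\<Union>\<alpha>\<in>Field wk. A \<alpha>) \<subseteq> Field lam"
      by (intro UN_least) (auto simp: Field_wk)
    moreover have "stage_union i \<subseteq> (\<Union>\<alpha>\<in>Field wk. A \<alpha>)" if "i \<in> Field kappa" for i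
      using that by (intro order_trans[OF union_le[of i 0]] UN_upper) (simp add: Field_wk)
    ultimately show ?thesis unfolding stage_union_cover by (rule subset_antisym[OF UN_least, rotated])
  qed
  moreover have "(A (ord_succ wk (k, i)), A (k, i)) \<in> F" if "i \<in> Field kappa" for k i
    using stage_union_F[OF that, of k] by (simp add: ord_succ_wk[OF that] A_def)
  then have "\<forall>\<alpha>\<in>Field wk. (A (ord_succ wk \<alpha>), A \<alpha>) \<in> F" by (auto simp: Field_wk)
  ultimately show ?thesis by blast
qed

end

theorem theorem1p1:
  fixes lam :: "'a rel"
    and kappa :: "'k rel"
    and L :: "'k \<Rightarrow> 'c rel"
    and F :: "('a set \<times> 'a set) set"
    and g :: "'k \<Rightarrow> 'a set \<times> 'a set \<Rightarrow> 'a set"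
  assumes lam_singular: "singular_card lam"
    and kappa_cof: "is_cofinality lam kappa"
    and L_card: "\<And>i. i \<in> Field kappa \<Longrightarrow> Card_order (L i)"
    and L_incr: "card_increasing kappa L"
    and L_cont: "card_continuous kappa L"
    and L_zero: "L (ord_zero kappa) =o (czero :: 'c rel)"
    and L_one: "kappa \<le>o L (ord_succ kappa (ord_zero kappa))"
    and lam_sum: "lam =o |SIGMA i : Field kappa. Field (L i)|"
    and F_pairs: "\<And>A B. (A, B) \<in> F \<Longrightarrow> B \<subseteq> A \<and> A \<subseteq> Field lam"
    and g_maps: "\<And>i. i \<in> Field kappa \<Longrightarrow> is_succ kappa i \<Longrightarrow>
      g i \<in> subsets_of_card0 lam (L i) \<times> subsets_of_card0 lam (L i) \<rightarrow> subsets_of_card0 lam (L i)"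
    and hyp_I: "\<And>i A1 A2. \<lbrakk>i \<in> Field kappa; is_succ kappa i;
        A1 \<in> subsets_of_card0 lam (L i); A2 \<in> subsets_of_card0 lam (L i); A1 \<subseteq> A2;
        A1 \<in> {{}} \<union> g i ` (subsets_of_card0 lam (L i) \<times> subsets_of_card0 lam (L i))\<rbrakk>
      \<Longrightarrow> A2 \<subseteq> g i (A1, A2) \<and> (g i (A1, A2), A1) \<in> F"
    and hyp_II: "\<And>i i' A B. \<lbrakk>i \<in> Field kappa; i' = ord_succ kappa i;
        A \<in> subsets_of_card0 lam (L i'); B \<in> subsets_of_card0 lam (L i'); A \<subseteq> B; (B, A) \<in> F;
        B \<in> g i' ` (subsets_of_card0 lam (L i') \<times> subsets_of_card0 lam (L i'))\<rbrakk>
      \<Longrightarrow> \<exists>\<sigma>. winning_strategy_II F (subsets_of_card lam (L i)) A B \<sigma>"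
  shows "\<exists>A :: nat \<times> 'k \<Rightarrow> 'a set.
      relChain (ord_prod natLeq kappa) A \<and>
      set_continuous (ord_prod natLeq kappa) A \<and>
      A (ord_zero (ord_prod natLeq kappa)) = {} \<and>
      Field lam = (\<Union>\<alpha>\<in>Field (ord_prod natLeq kappa). A \<alpha>) \<and>
      (\<forall>\<alpha>\<in>Field (ord_prod natLeq kappa).
         (A (ord_succ (ord_prod natLeq kappa) \<alpha>), A \<alpha>) \<in> F)"
proof -
  have Clam: "Card_order lam" and inf_lam: "infinite (Field lam)"
    using lam_singular by (auto simp: singular_card_def cinfinite_def)
  have Ckappa: "Card_order kappa" using kappa_cof by (simp add: is_cofinality_def)
  \<comment> \<open>A cofinal set of size \<open>kappa\<close> is infinite, hence so is
    \<open>kappa\<close>.\<close>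
  obtain K where K: "K \<subseteq> Field lam" "cofinal K lam" "|K| =o kappa"
    using kappa_cof by (auto simp: is_cofinality_def)
  have "infinite K"
    by (rule infinite_cofinal[OF _ _ K(1,2)])
      (use Clam inf_lam in \<open>auto simp: card_order_on_well_order_on\<close>)
  moreover have "|K| =o |Field kappa|"
    using K(3) card_of_Field_ordIso[OF Ckappa] ordIso_symmetric ordIso_transitive by blast
  ultimately have inf_kappa: "infinite (Field kappa)" using card_of_ordIso_finite by blast
  have "|Field lam| =o |SIGMA i : Field kappa. Field (L i)|"
    using lam_sum card_of_Field_ordIso[OF Clam] ordIso_transitive by blast
  then obtain h where h: "bij_betw h (SIGMA i : Field kappa. Field (L i)) (Field lam)"
    unfolding card_of_ordIso[symmetric] using bij_betw_inv by blast
  \<comment> \<open>The copy inside \<open>lam\<close> of the \<open>i\<close>-th summand of the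
    disjoint sum.\<close>
  define P where "P i = h ` ({i} \<times> Field (L i))" for i
  have P_card: "|P i| =o L i" if "i \<in> Field kappa" for i
  proof -
    have "inj_on (\<lambda>x. h (i, x)) (Field (L i))"
      using h that by (auto simp: bij_betw_def inj_on_def)
    then have "bij_betw (\<lambda>x. h (i, x)) (Field (L i)) (P i)"
      by (auto simp: bij_betw_def P_def)
    then have "|P i| =o |Field (L i)|"
      unfolding card_of_ordIso[symmetric] using bij_betw_inv by blast
    then show ?thesis
      using card_of_Field_ordIso[OF L_card[OF that]] ordIso_transitive by blast
  qed
  have P_cover: "Field lam = (\<Union>i\<in>Field kappa. P i)"
    using h by (fastforce simp: bij_betw_def P_def)
  interpret singular_filtration lam kappa L F g P
    by unfold_locales (fact Ckappa inf_kappa L_card L_incr L_cont L_zero L_one P_card P_cover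
        g_maps hyp_I hyp_II)+
  show ?thesis by (rule ex_chain)
qed

end
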